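(* Let $\mathcal{C}$ be a simplicial complex on the ground set $[n]$ and let $\Lambda(\mathcal{C})$ be its Lawrence lifting. Then $\mathcal{A}_{\Lambda(\mathcal{C})}$ is normal if and only if $\mathcal{A}_{\mathcal{C}}$ is unimodular.
   Context: For a simplicial complex $\mathcal{C}$ on ground set $[m]$ and $\mathbf{d}=(d_1,\dots,d_m)$ with all $d_i\ge 2$, the matrix $\mathcal{A}_{\mathcal{C},\mathbf{d}}$ has columns indexed by $\mathbf{i}\in\prod_{j\in[m]}[d_j]$ and rows indexed by pairs $(F,e)$ with $F$ a facet (inclusion-maximal face) of $\mathcal{C}$ and $e\in\prod_{j\in F}[d_j]$; the entry in row $(F,e)$, column $\mathbf{i}$ is $1$ if $e=(i_j:j\in F)$ and $0$ otherwise. Here $\mathbf{d}=(2,\dots,2)$ and $\mathcal{A}_{\mathcal{C}}:=\mathcal{A}_{\mathcal{C},(2,\dots,2)}$. A matrix $A$ with $n$ columns is normal if $\mathbb{R}_{\ge0}A\cap\mathbb{Z}A=\mathbb{N}A$, where $\mathbb{Z}A=\{Az:z\in\mathbb{Z}^n\}$, $\mathbb{R}_{\ge0}A=\{Ar:r\in\mathbb{R}^n_{\ge0}\}$, $\mathbb{N}A=\{Az:z\in\mathbb{N}^n\}$. An integer matrix $A$ is unimodular if for every $b\in\mathbb{Z}A\cap\mathbb{R}_{\ge0}A$ the polyhedron $\{x:Ax=b,\ x\ge0\}$ has all vertices integral. The Lawrence lifting $\Lambda(\mathcal{C})$ of a complex $\mathcal{C}$ on $[n]$ is the simplicial complex on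 $[n+1]$ with facets $\{[n]\}\cup\{F\cup\{n+1\}: F \text{ a facet of } \mathcal{C}\}$. *)

theory Defs
  imports "HOL-Analysis.Analysis" "HOL-Analysis.Finite_Function_Topology"
begin

text \<open>The constant \<^const>\<open>simplicial_complex\<close> of HOL-Analysis is about geometric complexes of
  simplices in a Euclidean space; here a complex on the ground set \<open>{1..m}\<close> is the set of its
  faces.\<close>

definition complex_on :: "nat \<Rightarrow> nat set set \<Rightarrow> bool" where
  "complex_on m \<Delta> \<longleftrightarrow> \<Delta> \<subseteq> Pow {1..m} \<and> (\<forall>F\<in>\<Delta>. \<forall>G. G \<subseteq> F \<longrightarrow> G \<in> \<Delta>)"

definition facets :: "nat set set \<Rightarrow> nat set set" where
  "facets \<Delta> = {F \<in> \<Delta>. \<forall>G\<in>\<Delta>. F \<subseteq> G \<longrightarrow> G = F}"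

definition lawrence_lifting :: "nat \<Rightarrow> nat set set \<Rightarrow> nat set set" where
  "lawrence_lifting n \<Delta> =
     {G. \<exists>H \<in> {{1..n}} \<union> {insert (n + 1) F | F. F \<in> facets \<Delta>}. G \<subseteq> H}"

lemma complex_on_lawrence_lifting:
  assumes "complex_on n \<Delta>"
  shows "complex_on (n + 1) (lawrence_lifting n \<Delta>)"
proof -
  have "G \<subseteq> {1..n + 1}" if G: "G \<in> lawrence_lifting n \<Delta>" for G
  proof -
    from G consider "G \<subseteq> {1..n}" | F where "F \<in> facets \<Delta>" "G \<subseteq> insert (n + 1) F"
      by (auto simp: lawrence_lifting_def)
    then show ?thesis
    proof cases
      case 1
      then show ?thesis by (rule order_trans) simp
    next
      case 2
      have "F \<subseteq> {1..n}"
        using 2(1) assms by (auto simp: facets_def complex_on_def)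
      then have "insert (n + 1) F \<subseteq> {1..n + 1}" by auto
      with 2(2) show ?thesis by (rule order_trans)
    qed
  qed
  moreover have "K \<in> lawrence_lifting n \<Delta>" if "G \<in> lawrence_lifting n \<Delta>" "K \<subseteq> G" for G K
    using that unfolding lawrence_lifting_def by (auto intro: order_trans)
  ultimately show ?thesis
    by (simp add: complex_on_def subset_iff)
qed

text \<open>The generating sets in \<^const>\<open>lawrence_lifting\<close> are exactly its facets, unless \<open>\<Delta>\<close> is the
  full simplex: then \<open>{1..n}\<close> is contained in the facet \<open>{1..n + 1}\<close>.\<close>

lemma facets_lawrence_lifting:
  assumes "complex_on n \<Delta>" and "{1..n} \<notin> \<Delta>"
  shows "facets (lawrence_lifting n \<Delta>) =
           {{1..n}} \<union> {insert (n + 1) F | F. F \<in> facets \<Delta>}" (is "_ = ?X")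
proof -
  have sub: "F \<in> \<Delta> \<and> F \<subseteq> {1..n}" if "F \<in> facets \<Delta>" for F
    using that assms(1) by (auto simp: facets_def complex_on_def)
  have n: "n + 1 \<notin> F" if "F \<in> facets \<Delta>" for F
    using sub[OF that] by auto
  have top: "\<not> {1..n} \<subseteq> insert (n + 1) F" if F: "F \<in> facets \<Delta>" for F
  proof
    assume "{1..n} \<subseteq> insert (n + 1) F"
    moreover have "n + 1 \<notin> {1..n}" by simp
    ultimately have "{1..n} = F" using sub[OF F] by blast
    then show False using sub[OF F] assms(2) by simp
  qed
  have bot: "\<not> insert (n + 1) F \<subseteq> {1..n}" for F
    by simp
  have mid: "F' = F" if "insert (n + 1) F \<subseteq> insert (n + 1) F'"
    "F \<in> facets \<Delta>" "F' \<in> facets \<Delta>" for F F'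
  proof -
    have "F \<subseteq> F'" using that(1) n[OF that(2)] by blast
    then show ?thesis using that(2,3) by (simp add: facets_def)
  qed
  define X where "X = ?X"
  have L: "K \<in> lawrence_lifting n \<Delta> \<longleftrightarrow> (\<exists>H\<in>X. K \<subseteq> H)" for K
    by (simp add: lawrence_lifting_def X_def)
  have X: "G \<in> X \<longleftrightarrow> G = {1..n} \<or> (\<exists>F. F \<in> facets \<Delta> \<and> G = insert (n + 1) F)" for G
    by (auto simp only: X_def Un_iff mem_Collect_eq singleton_iff)
  have anti: "H = G" if "G \<in> X" "H \<in> X" "G \<subseteq> H" for G H
    using that top bot mid unfolding X by metis
  have "facets (lawrence_lifting n \<Delta>) = X"
  proof (intro set_eqI iffI)
    fix G assume "G \<in> facets (lawrence_lifting n \<Delta>)"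
    then have G: "G \<in> lawrence_lifting n \<Delta>"
      and max: "\<And>K. K \<in> lawrence_lifting n \<Delta> \<Longrightarrow> G \<subseteq> K \<Longrightarrow> K = G"
      by (simp_all add: facets_def)
    obtain H where H: "H \<in> X" "G \<subseteq> H" using G L by metis
    then have "H = G" using max[of H] L by blast
    then show "G \<in> X" using H(1) by simp
  next
    fix G assume G: "G \<in> X"
    have "K = G" if K: "K \<in> lawrence_lifting n \<Delta>" "G \<subseteq> K" for K
    proof -
      obtain H where H: "H \<in> X" "K \<subseteq> H" using K(1) L by metis
      then have "H = G" using anti[OF G H(1)] K(2) by simp
      then show ?thesis using H(2) K(2) by simp
    qed
    moreover have "G \<in> lawrence_lifting n \<Delta>" using G L by blast
    ultimately show "G \<in> facets (lawrence_lifting n \<Delta>)" by (simp add: facets_def)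
  qed
  then show ?thesis unfolding X_def .
qed

text \<open>Integer matrices with arbitrary finite row and column index sets; entries outside
  \<open>row_idx A \<times> col_idx A\<close> are irrelevant.\<close>

record ('r, 'c) int_matrix =
  row_idx :: "'r set"
  col_idx :: "'c set"
  entry :: "'r \<Rightarrow> 'c \<Rightarrow> int"

definition mat_apply :: "('r, 'c) int_matrix \<Rightarrow> ('c \<Rightarrow> real) \<Rightarrow> 'r \<Rightarrow> real" where
  "mat_apply A x = (\<lambda>r\<in>row_idx A. \<Sum>c\<in>col_idx A. of_int (entry A r c) * x c)"

definition int_span :: "('r, 'c) int_matrix \<Rightarrow> ('r \<Rightarrow> real) set" where
  "int_span A = mat_apply A ` (col_idx A \<rightarrow>\<^sub>E \<int>)"

definition nonneg_span :: "('r, 'c) int_matrix \<Rightarrow> ('r \<Rightarrow> real) set" where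
  "nonneg_span A = mat_apply A ` (col_idx A \<rightarrow>\<^sub>E {0..})"

definition nat_span :: "('r, 'c) int_matrix \<Rightarrow> ('r \<Rightarrow> real) set" where
  "nat_span A = mat_apply A ` (col_idx A \<rightarrow>\<^sub>E \<nat>)"

definition normal_matrix :: "('r, 'c) int_matrix \<Rightarrow> bool" where
  "normal_matrix A \<longleftrightarrow> nonneg_span A \<inter> int_span A = nat_span A"

text \<open>The polyhedron \<open>{x. A x = b, x \<ge> 0}\<close>. Its ambient space \<open>\<real>\<^sup>C\<close>, for \<open>C = col_idx A\<close>, is
  realised as the finitely supported functions with support in \<open>C\<close>: unlike the function space,
  their type is an instance of \<^class>\<open>real_vector\<close>, as required by
  \<^const>\<open>extreme_point_of\<close>.\<close>

definition fiber_polyhedron :: "('r, 'c) int_matrix \<Rightarrow> ('r \<Rightarrow> real) \<Rightarrow> ('c \<Rightarrow>\<^sub>0 real) set" where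
  "fiber_polyhedron A b =
     {x. Poly_Mapping.keys x \<subseteq> col_idx A \<and> mat_apply A (Poly_Mapping.lookup x) = b \<and>
         (\<forall>c\<in>col_idx A. 0 \<le> Poly_Mapping.lookup x c)}"

definition unimodular_matrix :: "('r, 'c) int_matrix \<Rightarrow> bool" where
  "unimodular_matrix A \<longleftrightarrow>
     (\<forall>b \<in> int_span A \<inter> nonneg_span A. \<forall>v.
        v extreme_point_of fiber_polyhedron A b \<longrightarrow>
          (\<forall>c\<in>col_idx A. Poly_Mapping.lookup v c \<in> \<int>))"

definition hierarchical_matrix ::
    "nat \<Rightarrow> nat set set \<Rightarrow> (nat \<Rightarrow> nat) \<Rightarrow> (nat set \<times> (nat \<Rightarrow> nat), nat \<Rightarrow> nat) int_matrix" where
  "hierarchical_matrix m \<Delta> d =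
     \<lparr>row_idx = (SIGMA F:facets \<Delta>. \<Pi>\<^sub>E j\<in>F. {1..d j}),
      col_idx = (\<Pi>\<^sub>E j\<in>{1..m}. {1..d j}),
      entry = (\<lambda>(F, e) i. if e = restrict i F then 1 else 0)\<rparr>"

definition binary_matrix ::
    "nat \<Rightarrow> nat set set \<Rightarrow> (nat set \<times> (nat \<Rightarrow> nat), nat \<Rightarrow> nat) int_matrix" where
  "binary_matrix m \<Delta> = hierarchical_matrix m \<Delta> (\<lambda>_. 2)"

end

theory Submission
  imports Defs
begin

text \<open>Write \<open>A\<close> for the matrix of the complex \<open>\<C>\<close>. Both sides say that a fibre of \<open>A\<close> over a vector of
  the lattice spanned by the columns has an integral point in every integral box in which it has a
  real one. If \<open>\<C>\<close> is not the full simplex, the matrix of the lifting has the kernel of the block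
  matrix with rows \<open>(I, I)\<close> and \<open>(A, 0)\<close>, so its nonnegative fibres are pairs \<open>(x, u - x)\<close> with
  \<open>0 \<le> x \<le> u\<close> and \<open>A x\<close> prescribed, which matches normality with the box property. If \<open>A\<close> is
  unimodular, take a real point of the box with the fewest fractional coordinates: the
  restriction to these coordinates would be a nonintegral vertex of a fibre, or one could move along a kernel
  vector until a further coordinate becomes integral. Conversely, the box property, applied to a
  vertex \<open>v\<close> and the box \<open>0 \<le> x \<le> \<lceil>v\<rceil>\<close>, gives an integral point of the fibre whose support lies in
  that of \<open>v\<close>, and this must be \<open>v\<close> itself. For the full simplex both matrices are injective.\<close>

section \<open>Linear relations between images, and both matrix properties restated without
  spans\<close>

lemma mat_apply_eq_iff:
  "mat_apply A x = mat_apply A y \<longleftrightarrow>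
     (\<forall>r\<in>row_idx A. (\<Sum>c\<in>col_idx A. of_int (entry A r c) * x c) =
                     (\<Sum>c\<in>col_idx A. of_int (entry A r c) * y c))"
  unfolding mat_apply_def restrict_def fun_eq_iff by (metis (no_types, lifting))

lemma mat_apply_cong:
  "(\<And>c. c \<in> col_idx A \<Longrightarrow> x c = y c) \<Longrightarrow> mat_apply A x = mat_apply A y"
  by (simp add: mat_apply_eq_iff)

lemma mat_apply_add_eq:
  assumes "mat_apply A x = mat_apply A x'" "mat_apply A y = mat_apply A y'"
  shows "mat_apply A (\<lambda>c. s * x c + t * y c) = mat_apply A (\<lambda>c. s * x' c + t * y' c)"
proof -
  have "(\<Sum>c\<in>col_idx A. of_int (entry A r c) * (s * x c + t * y c)) =
      s * (\<Sum>c\<in>col_idx A. of_int (entry A r c) * x c) +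
      t * (\<Sum>c\<in>col_idx A. of_int (entry A r c) * y c)" for r and x y :: "'b \<Rightarrow> real"
    by (simp add: sum_distrib_left sum.distrib algebra_simps)
  then show ?thesis using assms by (simp add: mat_apply_eq_iff)
qed

text \<open>Kernel vectors always arise here as a difference \<open>d - d'\<close> of two vectors
  with the same image; this is the move along such a vector.\<close>

lemma mat_apply_translate:
  assumes "mat_apply A d = mat_apply A d'"
  shows "mat_apply A (\<lambda>c. x c + t * (d c - d' c)) = mat_apply A x"
proof -
  have "mat_apply A (\<lambda>c. 1 * x c + t * (1 * d c + (-1) * d' c)) =
      mat_apply A (\<lambda>c. 1 * x c + t * (1 * d' c + (-1) * d' c))"
    by (rule mat_apply_add_eq[OF refl mat_apply_add_eq[OF assms refl]])
  then show ?thesis by simp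
qed

text \<open>Only one inclusion of normality has content, as \<open>nat_span A\<close> always lies in
  the other two spans. Arbitrary functions replace extensional ones, so that witnesses need no care
  outside \<open>col_idx A\<close>.\<close>

lemma normal_matrix_iff:
  "normal_matrix A \<longleftrightarrow>
     (\<forall>x z. (\<forall>c\<in>col_idx A. 0 \<le> x c \<and> z c \<in> \<int>) \<longrightarrow> mat_apply A x = mat_apply A z \<longrightarrow>
        (\<exists>w. (\<forall>c\<in>col_idx A. w c \<in> \<nat>) \<and> mat_apply A w = mat_apply A x))"
    (is "_ \<longleftrightarrow> (\<forall>x z. ?P x z)")
proof
  let ?r = "\<lambda>x. restrict x (col_idx A)"
  have r: "mat_apply A (?r x) = mat_apply A x" for x
    by (rule mat_apply_cong) simp
  {
    assume N: "normal_matrix A"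
    show "\<forall>x z. ?P x z"
    proof (intro allI impI)
      fix x z
      assume xz: "\<forall>c\<in>col_idx A. 0 \<le> x c \<and> z c \<in> \<int>" and eq: "mat_apply A x = mat_apply A z"
      have "mat_apply A x \<in> nonneg_span A"
        unfolding nonneg_span_def by (rule image_eqI[of _ _ "?r x"]) (use xz r[of x] in auto)
      moreover have "mat_apply A x \<in> int_span A"
        unfolding int_span_def eq by (rule image_eqI[of _ _ "?r z"]) (use xz r[of z] in auto)
      ultimately have "mat_apply A x \<in> nat_span A"
        using N by (auto simp: normal_matrix_def)
      then obtain w where "w \<in> col_idx A \<rightarrow>\<^sub>E \<nat>" "mat_apply A x = mat_apply A w"
        unfolding nat_span_def by blast
      then show "\<exists>w. (\<forall>c\<in>col_idx A. w c \<in> \<nat>) \<and> mat_apply A w = mat_apply A x"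
        by (intro exI[of _ w]) (auto simp: PiE_def)
    qed
  }
  {
    assume P: "\<forall>x z. ?P x z"
    have "nat_span A \<subseteq> nonneg_span A \<inter> int_span A"
      unfolding nat_span_def nonneg_span_def int_span_def
      by (intro Int_greatest image_mono PiE_mono) (auto simp: Nats_subset_Ints[THEN subsetD] elim: Nats_cases)
    moreover have "nonneg_span A \<inter> int_span A \<subseteq> nat_span A"
    proof
      fix b assume "b \<in> nonneg_span A \<inter> int_span A"
      then obtain x z where xz: "x \<in> col_idx A \<rightarrow>\<^sub>E {0..}" "z \<in> col_idx A \<rightarrow>\<^sub>E \<int>"
        and b: "b = mat_apply A x" "b = mat_apply A z"
        by (auto simp: nonneg_span_def int_span_def)
      have "\<forall>c\<in>col_idx A. 0 \<le> x c \<and> z c \<in> \<int>" using xz by (auto simp: PiE_def Pi_def)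
      then obtain w where "\<forall>c\<in>col_idx A. w c \<in> \<nat>" "mat_apply A w = b"
        using P b by metis
      then show "b \<in> nat_span A"
        unfolding nat_span_def using r[of w] by (intro image_eqI[of _ _ "?r w"]) auto
    qed
    ultimately show "normal_matrix A" by (auto simp: normal_matrix_def)
  }
qed

text \<open>Membership of \<open>b\<close> in \<open>nonneg_span A\<close> may be dropped because
  the extreme point \<open>v\<close>, a point of the fibre, already witnesses it.\<close>

lemma unimodular_matrix_iff:
  "unimodular_matrix A \<longleftrightarrow>
     (\<forall>b z v. (\<forall>c\<in>col_idx A. z c \<in> \<int>) \<longrightarrow> mat_apply A z = b \<longrightarrow>
        v extreme_point_of fiber_polyhedron A b \<longrightarrow>
        (\<forall>c\<in>col_idx A. Poly_Mapping.lookup v c \<in> \<int>))" (is "_ \<longleftrightarrow> ?R")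
proof
  let ?r = "\<lambda>x. restrict x (col_idx A)"
  have r: "mat_apply A (?r x) = mat_apply A x" for x
    by (rule mat_apply_cong) simp
  {
    assume U: "unimodular_matrix A"
    show ?R
    proof (intro allI impI)
      fix b z v
      assume z: "\<forall>c\<in>col_idx A. z c \<in> \<int>" "mat_apply A z = b"
        and v: "v extreme_point_of fiber_polyhedron A b"
      have "b \<in> int_span A"
        unfolding int_span_def using z r[of z] by (intro image_eqI[of _ _ "?r z"]) auto
      moreover have "b \<in> nonneg_span A"
        unfolding nonneg_span_def using v r[of "Poly_Mapping.lookup v"]
        by (intro image_eqI[of _ _ "?r (Poly_Mapping.lookup v)"])
           (auto simp: extreme_point_of_def fiber_polyhedron_def)
      ultimately show "\<forall>c\<in>col_idx A. Poly_Mapping.lookup v c \<in> \<int>"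
        using U v unfolding unimodular_matrix_def by blast
    qed
  }
  {
    assume R: ?R
    show "unimodular_matrix A"
      unfolding unimodular_matrix_def
    proof (intro ballI allI impI)
      fix b v c
      assume b: "b \<in> int_span A \<inter> nonneg_span A"
        and v: "v extreme_point_of fiber_polyhedron A b" and c: "c \<in> col_idx A"
      from b obtain z where "z \<in> col_idx A \<rightarrow>\<^sub>E \<int>" "mat_apply A z = b"
        by (auto simp: int_span_def)
      then show "Poly_Mapping.lookup v c \<in> \<int>"
        using R v c by (metis PiE_mem)
    qed
  }
qed

text \<open>The vector \<open>z\<close> certifies that the common image lies in the lattice spanned
  by the columns. Boxes with lower corner 0 represent all integral boxes, by translating
  \<open>x\<close> and \<open>z\<close> by an integral vector.\<close>

definition box_integral :: "('r, 'c) int_matrix \<Rightarrow> bool" where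
  "box_integral A \<longleftrightarrow>
     (\<forall>u x z. (\<forall>c\<in>col_idx A. 0 \<le> x c \<and> x c \<le> u c \<and> u c \<in> \<int> \<and> z c \<in> \<int>) \<longrightarrow>
        mat_apply A x = mat_apply A z \<longrightarrow>
        (\<exists>w. (\<forall>c\<in>col_idx A. 0 \<le> w c \<and> w c \<le> u c \<and> w c \<in> \<int>) \<and>
             mat_apply A w = mat_apply A x))"

lemma box_integralI:
  assumes "\<And>u x z. \<lbrakk>\<And>c. c \<in> col_idx A \<Longrightarrow> 0 \<le> x c \<and> x c \<le> u c \<and> u c \<in> \<int> \<and> z c \<in> \<int>;
      mat_apply A x = mat_apply A z\<rbrakk> \<Longrightarrow>
      \<exists>w. (\<forall>c\<in>col_idx A. 0 \<le> w c \<and> w c \<le> u c \<and> w c \<in> \<int>) \<and> mat_apply A w = mat_apply A x"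
  shows "box_integral A"
  unfolding box_integral_def
proof (intro allI impI)
  fix u x z
  assume "\<forall>c\<in>col_idx A. 0 \<le> x c \<and> x c \<le> u c \<and> u c \<in> \<int> \<and> z c \<in> \<int>"
    "mat_apply A x = mat_apply A z"
  then show "\<exists>w. (\<forall>c\<in>col_idx A. 0 \<le> w c \<and> w c \<le> u c \<and> w c \<in> \<int>) \<and> mat_apply A w = mat_apply A x"
    by (intro assms[of x u z]) auto
qed

lemma box_integralD:
  assumes "box_integral A"
    and "\<And>c. c \<in> col_idx A \<Longrightarrow> 0 \<le> x c \<and> x c \<le> u c \<and> u c \<in> \<int> \<and> z c \<in> \<int>"
    and "mat_apply A x = mat_apply A z"
  obtains w where "\<And>c. c \<in> col_idx A \<Longrightarrow> 0 \<le> w c \<and> w c \<le> u c \<and> w c \<in> \<int>"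
    "mat_apply A w = mat_apply A x"
  using assms unfolding box_integral_def by metis

section \<open>Equivalence of unimodularity and the box property\<close>

lemma lookup_scaleR: "Poly_Mapping.lookup (r *\<^sub>R p) c = r * Poly_Mapping.lookup p c"
  for p :: "'c \<Rightarrow>\<^sub>0 real"
proof -
  have "finite {c. r *\<^sub>R Poly_Mapping.lookup p c \<noteq> 0}"
    by (rule finite_subset[OF _ finite_keys[of p]]) (auto simp: in_keys_iff)
  then show ?thesis by (simp add: scaleR_poly_mapping_def)
qed

lemma ex_finitely_supported:
  fixes f :: "'c \<Rightarrow> real"
  assumes "finite C"
  obtains p where "Poly_Mapping.lookup p = (\<lambda>c. if c \<in> C then f c else 0)"
    "Poly_Mapping.keys p \<subseteq> C"
proof -
  let ?f = "\<lambda>c. if c \<in> C then f c else 0"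
  have "finite {c. ?f c \<noteq> 0}" by (rule finite_subset[OF _ assms]) auto
  then have "Poly_Mapping.lookup (Abs_poly_mapping ?f) = ?f"
    by (rule lookup_Abs_poly_mapping)
  then show ?thesis
    by (intro that) (auto simp: in_keys_iff split: if_splits)
qed

text \<open>A ratio test: let \<open>x\<close> move in direction \<open>d\<close> and stop at the
  first moment when a moving coordinate reaches the floor or ceiling of its initial value.\<close>

lemma move_to_integral_coordinate:
  fixes x d :: "'c \<Rightarrow> real"
  assumes "finite S" "\<And>c. c \<in> S \<Longrightarrow> x c \<notin> \<int>" "\<exists>c\<in>S. d c \<noteq> 0"
  obtains t where "\<And>c. c \<in> S \<Longrightarrow> of_int \<lfloor>x c\<rfloor> \<le> x c + t * d c \<and> x c + t * d c \<le> of_int \<lceil>x c\<rceil>"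
    "\<exists>c\<in>S. x c + t * d c \<in> \<int>"
proof -
  define D where "D = {c \<in> S. d c \<noteq> 0}"
  \<comment> \<open>\<open>\<tau> c\<close> is the time at which coordinate \<open>c\<close>, moving
    with velocity \<open>d c\<close>, reaches the end of its unit interval; it is used only for
    nonzero velocity.\<close>
  define \<tau> where "\<tau> c = (if d c > 0 then (of_int \<lceil>x c\<rceil> - x c) / d c else (of_int \<lfloor>x c\<rfloor> - x c) / d c)" for c
  define t where "t = Min (\<tau> ` D)"
  have D: "finite D" "D \<noteq> {}" using assms by (auto simp: D_def)
  have pos: "\<tau> c \<ge> 0" if "c \<in> D" for c
    using that by (auto simp: \<tau>_def D_def divide_nonpos_nonpos)
  have t0: "t \<ge> 0" using D pos by (simp add: t_def)
  have tle: "t \<le> \<tau> c" if "c \<in> D" for c using D that by (simp add: t_def)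
  obtain c0 where c0: "c0 \<in> D" "t = \<tau> c0"
    using Min_in[of "\<tau> ` D"] D unfolding t_def by blast
  have "x c0 + t * d c0 \<in> \<int>"
    using c0 by (auto simp: \<tau>_def D_def)
  moreover have "of_int \<lfloor>x c\<rfloor> \<le> x c + t * d c \<and> x c + t * d c \<le> of_int \<lceil>x c\<rceil>" if "c \<in> S" for c
  proof -
    consider "d c = 0" | "d c > 0" | "d c < 0" by linarith
    then show ?thesis
    proof cases
      case 1
      then show ?thesis by simp
    next
      case 2
      then have "t * d c \<le> \<tau> c * d c" "0 \<le> t * d c"
        using that t0 tle[of c] by (auto simp: D_def intro: mult_right_mono)
      moreover have "\<tau> c * d c = of_int \<lceil>x c\<rceil> - x c" using 2 by (simp add: \<tau>_def)
      ultimately show ?thesis using of_int_floor_le[of "x c"] by linarith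
    next
      case 3
      then have "\<tau> c * d c \<le> t * d c" "t * d c \<le> 0"
        using that t0 tle[of c] by (auto simp: D_def intro: mult_right_mono_neg mult_nonneg_nonpos)
      moreover have "\<tau> c * d c = of_int \<lfloor>x c\<rfloor> - x c" using 3 by (simp add: \<tau>_def)
      ultimately show ?thesis using le_of_int_ceiling[of "x c"] by linarith
    qed
  qed
  ultimately show ?thesis using that c0(1) by (auto simp: D_def)
qed

lemma unimodular_imp_box_integral:
  fixes A :: "('r, 'c) int_matrix"
  assumes fin: "finite (col_idx A)" and U: "unimodular_matrix A"
  shows "box_integral A"
proof (rule box_integralI)
  fix u x z
  assume "\<And>c. c \<in> col_idx A \<Longrightarrow> 0 \<le> x c \<and> x c \<le> u c \<and> u c \<in> \<int> \<and> z c \<in> \<int>"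
    and "mat_apply A x = mat_apply A z"
  \<comment> \<open>Descent on the number of fractional coordinates. Only \<open>x\<close> varies:
    every move preserves its image and the box, so \<open>u\<close> and \<open>z\<close> stay
    fixed.\<close>
  then show "\<exists>w. (\<forall>c\<in>col_idx A. 0 \<le> w c \<and> w c \<le> u c \<and> w c \<in> \<int>) \<and>
      mat_apply A w = mat_apply A x"
  proof (induction "card {c \<in> col_idx A. x c \<notin> \<int>}" arbitrary: x rule: less_induct)
    case less
    define S where "S = {c \<in> col_idx A. x c \<notin> \<int>}"
    have S: "S \<subseteq> col_idx A" "finite S" using fin by (auto simp: S_def)
    show ?case
    proof (cases "S = {}")
      case True
      then show ?thesis using less.prems by (intro exI[of _ x]) (auto simp: S_def)
    next
      case False
      obtain p where p: "Poly_Mapping.lookup p = (\<lambda>c. if c \<in> S then x c else 0)"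
          "Poly_Mapping.keys p \<subseteq> S"
        using ex_finitely_supported[OF S(2)] by blast
      define b where "b = mat_apply A (Poly_Mapping.lookup p)"
      \<comment> \<open>The image \<open>b\<close> of the fractional part \<open>p\<close> of the
        support lies in the lattice: subtract from \<open>z\<close> the coordinates of
        \<open>x\<close> outside \<open>S\<close>, which are integral.\<close>
      let ?z = "\<lambda>c. z c - (if c \<in> S then 0 else x c)"
      have "mat_apply A ?z = mat_apply A (\<lambda>c. 1 * z c + (-1) * (if c \<in> S then 0 else x c))"
        by simp
      also have "\<dots> = mat_apply A (\<lambda>c. 1 * x c + (-1) * (if c \<in> S then 0 else x c))"
        using less.prems(2) by (intro mat_apply_add_eq) auto
      also have "\<dots> = b"
        unfolding b_def by (rule mat_apply_cong) (simp add: p)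
      finally have zb: "mat_apply A ?z = b" .
      have "\<forall>c\<in>col_idx A. ?z c \<in> \<int>"
        using less.prems(1) by (auto simp: S_def)
      moreover obtain c0 where "c0 \<in> S" using False by blast
      then have "c0 \<in> col_idx A" "Poly_Mapping.lookup p c0 \<notin> \<int>"
        by (auto simp: p S_def)
      ultimately have "\<not> p extreme_point_of fiber_polyhedron A b"
        using U[unfolded unimodular_matrix_iff, rule_format, of ?z b p c0] zb by blast
      moreover have "p \<in> fiber_polyhedron A b"
        using p S less.prems(1) by (auto simp: fiber_polyhedron_def b_def)
      ultimately obtain q q' where q: "q \<in> fiber_polyhedron A b" "q' \<in> fiber_polyhedron A b"
        and seg: "p \<in> open_segment q q'"
        unfolding extreme_point_of_def by blast
      let ?q = "Poly_Mapping.lookup q" and ?q' = "Poly_Mapping.lookup q'"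
      define d where "d c = ?q c - ?q' c" for c
      from seg obtain s where s: "0 < s" "s < 1" "q \<noteq> q'" "p = (1 - s) *\<^sub>R q + s *\<^sub>R q'"
        by (auto simp: in_segment)
      \<comment> \<open>Outside \<open>S\<close> the point \<open>p\<close> vanishes, and it is a
        positive combination of the nonnegative \<open>q\<close> and \<open>q'\<close>. Hence both
        vanish there, and \<open>d\<close> moves fractional coordinates only.\<close>
      have q0: "?q c = 0 \<and> ?q' c = 0" if "c \<notin> S" for c
      proof (cases "c \<in> col_idx A")
        case True
        then have nn: "0 \<le> ?q c" "0 \<le> ?q' c" using q by (auto simp: fiber_polyhedron_def)
        have "(1 - s) * ?q c + s * ?q' c = 0"
          using arg_cong[OF s(4), of "\<lambda>p. Poly_Mapping.lookup p c"] that
          by (simp add: p lookup_add lookup_scaleR)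
        moreover have "0 \<le> (1 - s) * ?q c" "0 \<le> s * ?q' c"
          using s nn by auto
        ultimately have "(1 - s) * ?q c = 0" "s * ?q' c = 0" by linarith+
        then show ?thesis using s by auto
      next
        case False
        then show ?thesis using q by (auto simp: fiber_polyhedron_def in_keys_iff)
      qed
      have "\<exists>c\<in>S. d c \<noteq> 0"
      proof (rule ccontr)
        assume "\<not> ?thesis"
        then have "?q c = ?q' c" for c
          using q0[of c] by (cases "c \<in> S") (auto simp: d_def)
        then show False using s(3) by (simp add: poly_mapping_eqI)
      qed
      then obtain t where
        t: "\<And>c. c \<in> S \<Longrightarrow> of_int \<lfloor>x c\<rfloor> \<le> x c + t * d c \<and> x c + t * d c \<le> of_int \<lceil>x c\<rceil>"
          "\<exists>c\<in>S. x c + t * d c \<in> \<int>"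
        using move_to_integral_coordinate[OF S(2), of x d] by (auto simp: S_def)
      let ?y = "\<lambda>c. x c + t * d c"
      have y0: "?y c = x c" if "c \<notin> S" for c using q0[OF that] by (simp add: d_def)
      have Ay: "mat_apply A ?y = mat_apply A x"
        unfolding d_def using q by (intro mat_apply_translate) (auto simp: fiber_polyhedron_def)
      have "{c \<in> col_idx A. ?y c \<notin> \<int>} \<subseteq> S"
      proof
        fix c assume "c \<in> {c \<in> col_idx A. ?y c \<notin> \<int>}"
        then show "c \<in> S" using y0[of c] by (cases "c \<in> S") (auto simp: S_def)
      qed
      then have "{c \<in> col_idx A. ?y c \<notin> \<int>} \<subset> S"
        using t(2) by blast
      then have "card {c \<in> col_idx A. ?y c \<notin> \<int>} < card {c \<in> col_idx A. x c \<notin> \<int>}"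
        using S(2) by (auto simp: S_def intro: psubset_card_mono)
      \<comment> \<open>The bounds 0 and \<open>u c\<close> are integers, so the interval between
        floor and ceiling of \<open>x c\<close> lies within them.\<close>
      moreover have "0 \<le> ?y c \<and> ?y c \<le> u c \<and> u c \<in> \<int> \<and> z c \<in> \<int>" if c: "c \<in> col_idx A" for c
      proof (cases "c \<in> S")
        case True
        have "0 \<le> x c" "x c \<le> u c" "u c \<in> \<int>" using less.prems(1)[OF c] by auto
        then have "0 \<le> \<lfloor>x c\<rfloor>" "of_int \<lceil>x c\<rceil> \<le> u c"
          by (auto elim!: Ints_cases simp: ceiling_le_iff)
        then have "(0::real) \<le> of_int \<lfloor>x c\<rfloor>" "of_int \<lceil>x c\<rceil> \<le> u c" by auto
        then have "0 \<le> ?y c" "?y c \<le> u c" using t(1)[OF True] by linarith+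
        then show ?thesis using less.prems(1)[OF c] by blast
      next
        case False
        show ?thesis unfolding y0[OF False] by (rule less.prems(1)[OF c])
      qed
      ultimately show ?thesis
        using less.hyps[of ?y] less.prems(2) Ay by simp
    qed
  qed
qed

lemma box_integral_imp_unimodular:
  fixes A :: "('r, 'c) int_matrix"
  assumes fin: "finite (col_idx A)" and B: "box_integral A"
  shows "unimodular_matrix A"
  unfolding unimodular_matrix_iff
proof (intro allI impI)
  fix b z and p :: "'c \<Rightarrow>\<^sub>0 real"
  assume z: "\<forall>c\<in>col_idx A. z c \<in> \<int>" "mat_apply A z = b"
    and p: "p extreme_point_of fiber_polyhedron A b"
  define v where "v = Poly_Mapping.lookup p"
  have v: "mat_apply A v = b" "\<And>c. c \<in> col_idx A \<Longrightarrow> 0 \<le> v c" "\<And>c. c \<notin> col_idx A \<Longrightarrow> v c = 0"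
    using p by (auto simp: v_def extreme_point_of_def fiber_polyhedron_def in_keys_iff)
  \<comment> \<open>Rounding \<open>v\<close> up gives the smallest integral box containing it; in
    particular \<open>w\<close> vanishes wherever \<open>v\<close> does.\<close>
  obtain w where w: "\<And>c. c \<in> col_idx A \<Longrightarrow> 0 \<le> w c \<and> w c \<le> of_int \<lceil>v c\<rceil> \<and> w c \<in> \<int>"
    and Aw: "mat_apply A w = b"
    using box_integralD[OF B, of v "\<lambda>c. of_int \<lceil>v c\<rceil>" z] v z by auto
  obtain q where q: "Poly_Mapping.lookup q = (\<lambda>c. if c \<in> col_idx A then w c else 0)"
      "Poly_Mapping.keys q \<subseteq> col_idx A"
    using ex_finitely_supported[OF fin] by blast
  have Aq: "mat_apply A (Poly_Mapping.lookup q) = b"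
    unfolding Aw[symmetric] by (rule mat_apply_cong) (simp add: q)
  \<comment> \<open>A step size for which \<open>v + \<epsilon> * (v - w)\<close> stays nonnegative,
    found by induction over the finitely many columns.\<close>
  have "\<exists>\<epsilon>>0. \<forall>c\<in>C. 0 < v c \<longrightarrow> \<epsilon> * w c \<le> v c" if "finite C" "C \<subseteq> col_idx A" for C
    using that
  proof (induction C)
    case empty
    show ?case by (auto intro: exI[of _ 1])
  next
    case (insert a C)
    then obtain \<epsilon> where e: "\<epsilon> > 0" "\<And>c. c \<in> C \<Longrightarrow> 0 < v c \<Longrightarrow> \<epsilon> * w c \<le> v c" by auto
    \<comment> \<open>The default 1 serves when \<open>v a = 0\<close>, where nothing is required,
      and when \<open>w a = 0\<close>, where every step is admissible.\<close>
    define \<delta> where "\<delta> = (if 0 < v a \<and> 0 < w a then v a / w a else 1)"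
    have d: "\<delta> > 0" "0 < v a \<Longrightarrow> \<delta> * w a \<le> v a"
      using w[of a] insert.prems by (auto simp: \<delta>_def)
    have "min \<epsilon> \<delta> * w c \<le> v c" if "c \<in> insert a C" "0 < v c" for c
    proof -
      have "0 \<le> w c" using w[of c] that insert.prems by auto
      then have "min \<epsilon> \<delta> * w c \<le> \<epsilon> * w c" "min \<epsilon> \<delta> * w c \<le> \<delta> * w c"
        by (auto intro: mult_right_mono)
      then show ?thesis using that e(2)[of c] d(2) by force
    qed
    then show ?case using e(1) d(1) by (intro exI[of _ "min \<epsilon> \<delta>"]) auto
  qed
  from this[OF fin] obtain \<epsilon> where
    e: "\<epsilon> > 0" "\<And>c. c \<in> col_idx A \<Longrightarrow> 0 < v c \<Longrightarrow> \<epsilon> * w c \<le> v c" by auto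
  \<comment> \<open>\<open>q'\<close> lies on the line from \<open>q\<close> through
    \<open>p\<close>, beyond \<open>p\<close>. If \<open>q\<close> differed from \<open>p\<close>,
    then \<open>p\<close> would be interior to a segment of the fibre.\<close>
  define q' where "q' = p + \<epsilon> *\<^sub>R (p - q)"
  have q': "Poly_Mapping.lookup q' c = v c + \<epsilon> * (v c - Poly_Mapping.lookup q c)" for c
    by (simp add: q'_def lookup_add lookup_minus lookup_scaleR v_def)
  have "q \<in> fiber_polyhedron A b"
    using w Aq q by (auto simp: fiber_polyhedron_def)
  moreover have "q' \<in> fiber_polyhedron A b"
  proof -
    have "Poly_Mapping.lookup q' c = 0" if "c \<notin> col_idx A" for c
      using v(3)[OF that] that by (simp add: q' q)
    then have "Poly_Mapping.keys q' \<subseteq> col_idx A"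
      unfolding in_keys_iff subset_iff by metis
    moreover have "mat_apply A (Poly_Mapping.lookup q') = b"
      using mat_apply_translate[of A v "Poly_Mapping.lookup q" v \<epsilon>] v Aq
      unfolding q'[abs_def, symmetric] by (simp add: q' fun_eq_iff[symmetric])
    moreover have "0 \<le> Poly_Mapping.lookup q' c" if "c \<in> col_idx A" for c
    proof (cases "v c = 0")
      case True
      then have "w c = 0" using w[OF that] by simp
      then show ?thesis using True by (simp add: q' q)
    next
      case False
      then have "0 < v c" "\<epsilon> * w c \<le> v c" "0 \<le> \<epsilon> * v c"
        using v(2)[OF that] e(1) e(2)[OF that] by auto
      then show ?thesis using that by (simp add: q' q algebra_simps)
    qed
    ultimately show ?thesis by (simp add: fiber_polyhedron_def)
  qed
  ultimately have not_seg: "p \<notin> open_segment q q'"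
    using p by (auto simp: extreme_point_of_def)
  have "q = p"
  proof (rule ccontr)
    assume "q \<noteq> p"
    \<comment> \<open>The position of \<open>p\<close> on the segment from \<open>q\<close> to
      \<open>q'\<close>, since \<open>q' - q\<close> is \<open>1 + \<epsilon>\<close> times
      \<open>p - q\<close>.\<close>
    define s where "s = 1 / (1 + \<epsilon>)"
    have s: "0 < s" "s < 1" "s + s * \<epsilon> = 1" using e(1) by (auto simp: s_def field_simps)
    have "q' - q = (1 + \<epsilon>) *\<^sub>R (p - q)"
      by (simp add: q'_def algebra_simps)
    then have "q \<noteq> q'" using \<open>q \<noteq> p\<close> e(1) by auto
    moreover have "(1 - s) *\<^sub>R q + s *\<^sub>R q' = q + s *\<^sub>R (q' - q)"
      by (simp add: algebra_simps)
    then have "(1 - s) *\<^sub>R q + s *\<^sub>R q' = q + (s + s * \<epsilon>) *\<^sub>R (p - q)"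
      using \<open>q' - q = _\<close> by (simp add: distrib_left)
    then have "p = (1 - s) *\<^sub>R q + s *\<^sub>R q'" using s(3) by simp
    ultimately have "p \<in> open_segment q q'" using s by (auto simp: in_segment)
    with not_seg show False by simp
  qed
  then show "\<forall>c\<in>col_idx A. Poly_Mapping.lookup p c \<in> \<int>"
    using w q by auto
qed

text \<open>The maps \<open>g\<close> and \<open>h\<close> index two copies of the columns of
  \<open>A\<close>. Once the sums over both copies are fixed as \<open>u\<close>, a nonnegative
  vector is a pair \<open>(x, u - x)\<close>, and its nonnegativity says that \<open>x\<close> lies
  in the box below \<open>u\<close>.\<close>

lemma normal_lawrence_iff_box_integral:
  fixes A :: "('r, 'c) int_matrix" and L :: "('s, 'd) int_matrix"
  assumes cols: "col_idx L = g ` col_idx A \<union> h ` col_idx A"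
    and inj: "inj_on g (col_idx A)" "inj_on h (col_idx A)"
    and disj: "g ` col_idx A \<inter> h ` col_idx A = {}"
    and kernel: "\<And>x y. mat_apply L x = mat_apply L y \<longleftrightarrow>
      (\<forall>c\<in>col_idx A. x (g c) + x (h c) = y (g c) + y (h c)) \<and>
      mat_apply A (x \<circ> g) = mat_apply A (y \<circ> g) \<and> mat_apply A (x \<circ> h) = mat_apply A (y \<circ> h)"
  shows "normal_matrix L \<longleftrightarrow> box_integral A"
proof -
  \<comment> \<open>The vector equal to \<open>x\<close> on the first copy and to \<open>y\<close>
    on the second. The \<open>else\<close> branch also covers indices that are not columns of
    \<open>L\<close>, where the value is irrelevant.\<close>
  define join where "join x y d = (if d \<in> g ` col_idx A then x (inv_into (col_idx A) g d)
    else y (inv_into (col_idx A) h d))" for x y :: "'c \<Rightarrow> real" and d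
  have join: "join x y (g c) = x c" "join x y (h c) = y c" if "c \<in> col_idx A" for x y c
    using that inj disj by (auto simp: join_def)
  \<comment> \<open>The sums and the equation on the first copy imply the one on the second, so the
    latter need not be checked again.\<close>
  have kernel': "mat_apply L x = mat_apply L y \<longleftrightarrow>
      (\<forall>c\<in>col_idx A. x (g c) + x (h c) = y (g c) + y (h c)) \<and>
      mat_apply A (x \<circ> g) = mat_apply A (y \<circ> g)" for x y
  proof -
    have "mat_apply A (x \<circ> h) = mat_apply A (y \<circ> h)"
      if s: "\<forall>c\<in>col_idx A. x (g c) + x (h c) = y (g c) + y (h c)"
        and e: "mat_apply A (x \<circ> g) = mat_apply A (y \<circ> g)"
    proof -
      have "mat_apply A (x \<circ> h) = mat_apply A (\<lambda>c. (y \<circ> h) c + (-1) * ((x \<circ> g) c - (y \<circ> g) c))"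
        by (rule mat_apply_cong) (use s in \<open>force\<close>)
      also have "\<dots> = mat_apply A (y \<circ> h)"
        by (rule mat_apply_translate[OF e])
      finally show ?thesis .
    qed
    then show ?thesis unfolding kernel by blast
  qed
  show ?thesis
  proof
    assume N: "normal_matrix L"
    show "box_integral A"
    proof (rule box_integralI)
      fix u x z
      assume a: "\<And>c. c \<in> col_idx A \<Longrightarrow> 0 \<le> x c \<and> x c \<le> u c \<and> u c \<in> \<int> \<and> z c \<in> \<int>"
        and eq: "mat_apply A x = mat_apply A z"
      \<comment> \<open>Both pairs have copy sums \<open>u\<close>, and \<open>?z\<close> is
        integral because \<open>u\<close> and \<open>z\<close> are.\<close>
      let ?x = "join x (\<lambda>c. u c - x c)" and ?z = "join z (\<lambda>c. u c - z c)"
      have g: "mat_apply A (join y y' \<circ> g) = mat_apply A y" for y y'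
        by (rule mat_apply_cong) (simp add: join)
      have "\<forall>d\<in>col_idx L. 0 \<le> ?x d \<and> ?z d \<in> \<int>"
        unfolding cols using a by (auto simp: join)
      moreover have "mat_apply L ?x = mat_apply L ?z"
        unfolding kernel' using eq by (simp add: g join)
      ultimately obtain w where w: "\<forall>d\<in>col_idx L. w d \<in> \<nat>" "mat_apply L w = mat_apply L ?x"
        using N unfolding normal_matrix_iff by blast
      have "0 \<le> (w \<circ> g) c \<and> (w \<circ> g) c \<le> u c \<and> (w \<circ> g) c \<in> \<int>" if c: "c \<in> col_idx A" for c
      proof -
        have "w (g c) \<in> \<nat>" "w (h c) \<in> \<nat>" using w(1) c cols by auto
        moreover have "w (g c) + w (h c) = u c"
          using w(2) c unfolding kernel' by (simp add: join)
        ultimately show ?thesis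
          using Nats_subset_Ints by (auto elim!: Nats_cases)
      qed
      moreover have "mat_apply A (w \<circ> g) = mat_apply A x"
        using w(2) unfolding kernel' g by blast
      ultimately show "\<exists>w. (\<forall>c\<in>col_idx A. 0 \<le> w c \<and> w c \<le> u c \<and> w c \<in> \<int>) \<and>
          mat_apply A w = mat_apply A x"
        by blast
    qed
  next
    assume B: "box_integral A"
    show "normal_matrix L"
      unfolding normal_matrix_iff
    proof (intro allI impI)
      fix x z
      assume a: "\<forall>d\<in>col_idx L. 0 \<le> x d \<and> z d \<in> \<int>" and eq: "mat_apply L x = mat_apply L z"
      have s: "x (g c) + x (h c) = z (g c) + z (h c)" if "c \<in> col_idx A" for c
        using eq that unfolding kernel' by blast
      have a': "0 \<le> x (g c)" "0 \<le> x (h c)" "z (g c) \<in> \<int>" "z (h c) \<in> \<int>" if "c \<in> col_idx A" for c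
        using a that cols by auto
      \<comment> \<open>The copy sums of \<open>x\<close> serve as the upper corner of the box; they
        are integral because they agree with those of \<open>z\<close>.\<close>
      have b: "0 \<le> (x \<circ> g) c \<and> (x \<circ> g) c \<le> z (g c) + z (h c) \<and> z (g c) + z (h c) \<in> \<int> \<and> (z \<circ> g) c \<in> \<int>"
        if "c \<in> col_idx A" for c
        using s[OF that] a'[OF that] by (metis Ints_add add_increasing2 comp_apply order_refl)
      have "mat_apply A (x \<circ> g) = mat_apply A (z \<circ> g)"
        using eq unfolding kernel' by blast
      from box_integralD[OF B b this] obtain w where
        w: "\<And>c. c \<in> col_idx A \<Longrightarrow> 0 \<le> w c \<and> w c \<le> z (g c) + z (h c) \<and> w c \<in> \<int>"
          "mat_apply A w = mat_apply A (x \<circ> g)"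
        by metis
      let ?w = "join w (\<lambda>c. z (g c) + z (h c) - w c)"
      have "\<forall>d\<in>col_idx L. ?w d \<in> \<nat>"
        unfolding cols using w(1) a' by (auto simp: join Nats_altdef2)
      moreover have "mat_apply A (?w \<circ> g) = mat_apply A w"
        by (rule mat_apply_cong) (simp add: join)
      then have "mat_apply L ?w = mat_apply L x"
        unfolding kernel' using w(2) s by (simp add: join)
      ultimately show "\<exists>w. (\<forall>d\<in>col_idx L. w d \<in> \<nat>) \<and> mat_apply L w = mat_apply L x" by blast
    qed
  qed
qed

section \<open>Marginals of hierarchical matrices and of their Lawrence liftings\<close>

lemma mat_apply_hierarchical_eq_iff:
  "mat_apply (hierarchical_matrix m \<Delta> d) x = mat_apply (hierarchical_matrix m \<Delta> d) y \<longleftrightarrow>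
     (\<forall>F\<in>facets \<Delta>. \<forall>e\<in>\<Pi>\<^sub>E j\<in>F. {1..d j}.
        (\<Sum>i\<in>Pi\<^sub>E {1..m} (\<lambda>j. {1..d j}). if e = restrict i F then x i else 0) =
        (\<Sum>i\<in>Pi\<^sub>E {1..m} (\<lambda>j. {1..d j}). if e = restrict i F then y i else 0))"
  unfolding mat_apply_eq_iff
  by (simp add: hierarchical_matrix_def if_distrib[of of_int] mult_if_delta cong: if_cong)

lemma finite_col_idx_hierarchical: "finite (col_idx (hierarchical_matrix m \<Delta> d))"
  by (simp add: hierarchical_matrix_def finite_PiE)

lemma sum_PiE_restrict_self:
  fixes x :: "('a \<Rightarrow> 'b) \<Rightarrow> real"
  assumes "finite I" "\<And>j. j \<in> I \<Longrightarrow> finite (B j)" "e \<in> Pi\<^sub>E I B"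
  shows "(\<Sum>i\<in>Pi\<^sub>E I B. if e = restrict i I then x i else 0) = x e"
proof -
  have "(\<Sum>i\<in>Pi\<^sub>E I B. if e = restrict i I then x i else 0) =
      (\<Sum>i\<in>Pi\<^sub>E I B. if e = i then x i else 0)"
    by (intro sum.cong) (simp_all add: PiE_restrict)
  also have "\<dots> = x e" using assms by (simp add: finite_PiE)
  finally show ?thesis .
qed

text \<open>With the whole ground set as only facet, each column has a row of its own, so the
  marginals are the coordinates themselves.\<close>

lemma mat_apply_hierarchical_simplex_eq_iff:
  assumes "facets \<Delta> = {{1..m}}"
  shows "mat_apply (hierarchical_matrix m \<Delta> d) x = mat_apply (hierarchical_matrix m \<Delta> d) y \<longleftrightarrow>
     (\<forall>c\<in>col_idx (hierarchical_matrix m \<Delta> d). x c = y c)"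
  unfolding mat_apply_hierarchical_eq_iff assms
  by (simp add: hierarchical_matrix_def finite_PiE)

lemma facets_simplex:
  assumes "complex_on m \<Delta>" "{1..m} \<in> \<Delta>"
  shows "facets \<Delta> = {{1..m}}"
proof -
  have "F \<subseteq> {1..m}" if "F \<in> \<Delta>" for F
    using assms(1) that unfolding complex_on_def by blast
  with assms(2) show ?thesis unfolding facets_def by blast
qed

lemma restrict_fun_upd_eq_iff:
  assumes "a \<notin> F" "e \<in> extensional (insert a F)"
  shows "e = restrict (i(a := k)) (insert a F) \<longleftrightarrow> e a = k \<and> restrict e F = restrict i F"
proof
  assume "e = restrict (i(a := k)) (insert a F)"
  then show "e a = k \<and> restrict e F = restrict i F"
    using assms(1) by (auto intro: restrict_ext)
next
  assume e: "e a = k \<and> restrict e F = restrict i F"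
  show "e = restrict (i(a := k)) (insert a F)"
  proof
    fix j show "e j = restrict (i(a := k)) (insert a F) j"
      using conjunct1[OF e] assms fun_cong[OF conjunct2[OF e], of j]
      by (cases "j \<in> F") (auto simp: extensional_def)
  qed
qed

text \<open>The two levels of the new vertex \<open>n + 1\<close> split the columns of the lifting
  into two slices, each a copy of the columns on \<open>{1..n}\<close>.\<close>

lemma sum_PiE_Suc:
  fixes f :: "(nat \<Rightarrow> nat) \<Rightarrow> real"
  assumes "d (n + 1) = 2"
  shows "sum f (Pi\<^sub>E {1..n + 1} (\<lambda>j. {1..d j})) =
    (\<Sum>i\<in>Pi\<^sub>E {1..n} (\<lambda>j. {1..d j}). f (i(n + 1 := 1)) + f (i(n + 1 := 2)))"
proof -
  let ?B = "\<lambda>j. {1..d j}"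
  have ins: "{1..n + 1} = insert (n + 1) {1..n}" by auto
  have two: "?B (n + 1) = {1, 2}" using assms by auto
  have "sum f (Pi\<^sub>E {1..n + 1} ?B) =
      (\<Sum>p\<in>?B (n + 1) \<times> Pi\<^sub>E {1..n} ?B. f (case p of (y, g) \<Rightarrow> g(n + 1 := y)))"
    unfolding ins PiE_insert_eq by (subst sum.reindex) (auto intro!: inj_combinator)
  also have "\<dots> = (\<Sum>y\<in>?B (n + 1). \<Sum>g\<in>Pi\<^sub>E {1..n} ?B. f (g(n + 1 := y)))"
    by (simp add: sum.cartesian_product split_def)
  also have "\<dots> = (\<Sum>i\<in>Pi\<^sub>E {1..n} ?B. f (i(n + 1 := 1)) + f (i(n + 1 := 2)))"
    unfolding two by (simp add: sum.distrib)
  finally show ?thesis .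
qed

text \<open>The facet \<open>{1..n}\<close> forgets the level of the new vertex, so its rows form
  the block \<open>(I, I)\<close>.\<close>

lemma marginal_lawrence_base:
  fixes x :: "(nat \<Rightarrow> nat) \<Rightarrow> real"
  assumes d: "d (n + 1) = 2" and e: "e \<in> Pi\<^sub>E {1..n} (\<lambda>j. {1..d j})"
  shows "(\<Sum>i\<in>Pi\<^sub>E {1..n + 1} (\<lambda>j. {1..d j}). if e = restrict i {1..n} then x i else 0) =
    x (e(n + 1 := 1)) + x (e(n + 1 := 2))"
proof -
  have r: "restrict (i(n + 1 := k)) {1..n} = restrict i {1..n}" for i :: "nat \<Rightarrow> nat" and k
    by (auto simp: restrict_def)
  have "(\<Sum>i\<in>Pi\<^sub>E {1..n + 1} (\<lambda>j. {1..d j}). if e = restrict i {1..n} then x i else 0) =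
    (\<Sum>i\<in>Pi\<^sub>E {1..n} (\<lambda>j. {1..d j}). if e = restrict i {1..n}
       then x (i(n + 1 := 1)) + x (i(n + 1 := 2)) else 0)"
    unfolding sum_PiE_Suc[of d, OF d] r by (intro sum.cong) auto
  also have "\<dots> = x (e(n + 1 := 1)) + x (e(n + 1 := 2))"
    using e by (intro sum_PiE_restrict_self) auto
  finally show ?thesis .
qed

text \<open>A row of a facet through \<open>n + 1\<close> selects the slice \<open>e (n + 1)\<close>
  and acts there as the row \<open>restrict e F\<close> of the original matrix.\<close>

lemma marginal_lawrence_cone:
  fixes x :: "(nat \<Rightarrow> nat) \<Rightarrow> real"
  assumes d: "d (n + 1) = 2" and F: "F \<subseteq> {1..n}"
    and e: "e \<in> Pi\<^sub>E (insert (n + 1) F) (\<lambda>j. {1..d j})"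
  shows "(\<Sum>i\<in>Pi\<^sub>E {1..n + 1} (\<lambda>j. {1..d j}).
      if e = restrict i (insert (n + 1) F) then x i else 0) =
    (\<Sum>i\<in>Pi\<^sub>E {1..n} (\<lambda>j. {1..d j}).
      if restrict e F = restrict i F then x (i(n + 1 := e (n + 1))) else 0)"
proof -
  have "n + 1 \<notin> F" "e \<in> extensional (insert (n + 1) F)"
    using F e by (auto simp: PiE_def)
  note r = restrict_fun_upd_eq_iff[OF this]
  have "e (n + 1) \<in> {1..d (n + 1)}" using e by blast
  then have "e (n + 1) = 1 \<or> e (n + 1) = 2" using d by auto
  then show ?thesis
    unfolding sum_PiE_Suc[of d, OF d] r by (intro sum.cong) auto
qed

text \<open>In terms of the two slices, the rows of the lifting are those of \<open>(I, I)\<close>,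
  \<open>(A, 0)\<close> and \<open>(0, A)\<close>. This is the kernel hypothesis of
  \<open>normal_lawrence_iff_box_integral\<close>.\<close>

lemma mat_apply_lawrence_eq_iff:
  fixes n d \<Delta>
  defines "A \<equiv> hierarchical_matrix n \<Delta> d"
    and "L \<equiv> hierarchical_matrix (n + 1) (lawrence_lifting n \<Delta>) d"
  assumes \<Delta>: "complex_on n \<Delta>" "{1..n} \<notin> \<Delta>" and d: "d (n + 1) = 2"
  shows "mat_apply L x = mat_apply L y \<longleftrightarrow>
    (\<forall>c\<in>col_idx A. x (c(n + 1 := 1)) + x (c(n + 1 := 2)) = y (c(n + 1 := 1)) + y (c(n + 1 := 2))) \<and>
    mat_apply A (x \<circ> (\<lambda>c. c(n + 1 := 1))) = mat_apply A (y \<circ> (\<lambda>c. c(n + 1 := 1))) \<and>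
    mat_apply A (x \<circ> (\<lambda>c. c(n + 1 := 2))) = mat_apply A (y \<circ> (\<lambda>c. c(n + 1 := 2)))"
    (is "_ \<longleftrightarrow> ?base \<and> ?cone 1 \<and> ?cone 2")
proof -
  let ?B = "\<lambda>j. {1..d j}"
  define M where "M F e x = (\<Sum>i\<in>Pi\<^sub>E {1..n} ?B. if e = restrict i F then x i else 0)"
    for F e and x :: "(nat \<Rightarrow> nat) \<Rightarrow> real"
  define M' where "M' F e x = (\<Sum>i\<in>Pi\<^sub>E {1..n + 1} ?B. if e = restrict i F then x i else 0)"
    for F e and x :: "(nat \<Rightarrow> nat) \<Rightarrow> real"
  have F: "F \<subseteq> {1..n}" if "F \<in> facets \<Delta>" for F
    using that \<Delta>(1) by (auto simp: facets_def complex_on_def)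
  have "mat_apply L x = mat_apply L y \<longleftrightarrow>
      (\<forall>F\<in>facets (lawrence_lifting n \<Delta>). \<forall>e\<in>Pi\<^sub>E F ?B. M' F e x = M' F e y)"
    unfolding L_def M'_def by (rule mat_apply_hierarchical_eq_iff)
  also have "\<dots> \<longleftrightarrow> (\<forall>e\<in>Pi\<^sub>E {1..n} ?B. M' {1..n} e x = M' {1..n} e y) \<and>
      (\<forall>F\<in>facets \<Delta>. \<forall>e\<in>Pi\<^sub>E (insert (n + 1) F) ?B.
         M' (insert (n + 1) F) e x = M' (insert (n + 1) F) e y)"
    unfolding facets_lawrence_lifting[OF \<Delta>] by blast
  also have "(\<forall>e\<in>Pi\<^sub>E {1..n} ?B. M' {1..n} e x = M' {1..n} e y) \<longleftrightarrow> ?base"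
    unfolding M'_def A_def hierarchical_matrix_def
    by (simp add: marginal_lawrence_base[where d = d, OF d, simplified])
  also have "(\<forall>F\<in>facets \<Delta>. \<forall>e\<in>Pi\<^sub>E (insert (n + 1) F) ?B.
       M' (insert (n + 1) F) e x = M' (insert (n + 1) F) e y) \<longleftrightarrow> (\<forall>k\<in>{1, 2}. ?cone k)"
  proof -
    have cone: "?cone k \<longleftrightarrow> (\<forall>F\<in>facets \<Delta>. \<forall>e\<in>Pi\<^sub>E F ?B.
        M F e (\<lambda>c. x (c(n + 1 := k))) = M F e (\<lambda>c. y (c(n + 1 := k))))" for k
      unfolding A_def mat_apply_hierarchical_eq_iff M_def o_def by simp
    \<comment> \<open>Rows over \<open>insert (n + 1) F\<close> correspond to pairs of a level
      \<open>k\<close> and a row \<open>e\<close> over \<open>F\<close>.\<close>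
    have "(\<forall>e\<in>Pi\<^sub>E (insert (n + 1) F) ?B.
        M' (insert (n + 1) F) e x = M' (insert (n + 1) F) e y) \<longleftrightarrow>
      (\<forall>k\<in>{1, 2}. \<forall>e\<in>Pi\<^sub>E F ?B.
        M F e (\<lambda>c. x (c(n + 1 := k))) = M F e (\<lambda>c. y (c(n + 1 := k))))"
      (is "?l \<longleftrightarrow> ?r") if "F \<in> facets \<Delta>" for F
    proof -
      have M': "M' (insert (n + 1) F) e x = M F (restrict e F) (\<lambda>c. x (c(n + 1 := e (n + 1))))"
        if "e \<in> Pi\<^sub>E (insert (n + 1) F) ?B" for e x
        unfolding M_def M'_def by (rule marginal_lawrence_cone[where d = d, OF d F[OF \<open>F \<in> facets \<Delta>\<close>] that])
      show ?thesis
      proof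
        assume l: ?l
        show ?r
        proof (intro ballI)
          fix k e assume k: "k \<in> {1, 2::nat}" and e: "e \<in> Pi\<^sub>E F ?B"
          let ?e = "e(n + 1 := k)"
          have e': "?e \<in> Pi\<^sub>E (insert (n + 1) F) ?B"
            by (rule PiE_fun_upd) (use k e d in auto)
          have "n + 1 \<notin> F" using F[OF \<open>F \<in> facets \<Delta>\<close>] by auto
          then have "restrict ?e F = e"
            using e by (auto simp: fun_eq_iff PiE_def extensional_def)
          then show "M F e (\<lambda>c. x (c(n + 1 := k))) = M F e (\<lambda>c. y (c(n + 1 := k)))"
            using l[rule_format, OF e'] unfolding M'[OF e'] by simp
        qed
      next
        assume r: ?r
        show ?l
        proof
          fix e assume e: "e \<in> Pi\<^sub>E (insert (n + 1) F) ?B"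
          then have "e (n + 1) \<in> {1..d (n + 1)}" by blast
          then have "e (n + 1) \<in> {1, 2}" using d by auto
          moreover have "restrict e F \<in> Pi\<^sub>E F ?B" using e by auto
          ultimately show "M' (insert (n + 1) F) e x = M' (insert (n + 1) F) e y"
            unfolding M'[OF e] using r by blast
        qed
      qed
    qed
    note eq = this
    have swap: "(\<forall>F\<in>X. \<forall>k\<in>Y. P F k) \<longleftrightarrow> (\<forall>k\<in>Y. \<forall>F\<in>X. P F k)"
      for X :: "nat set set" and Y :: "nat set" and P
      by blast
    show ?thesis
      unfolding cone swap[symmetric] by (rule ball_cong[OF refl eq])
  qed
  finally show ?thesis by (simp only: ball_simps simp_thms)
qed

lemma normal_hierarchical_lawrence_iff:
  assumes \<Delta>: "complex_on n \<Delta>" "{1..n} \<notin> \<Delta>" and d: "d (n + 1) = 2"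
  shows "normal_matrix (hierarchical_matrix (n + 1) (lawrence_lifting n \<Delta>) d) \<longleftrightarrow>
    box_integral (hierarchical_matrix n \<Delta> d)"
proof (rule normal_lawrence_iff_box_integral)
  let ?A = "hierarchical_matrix n \<Delta> d"
  let ?u = "\<lambda>k (c :: nat \<Rightarrow> nat). c(n + 1 := k)"
  \<comment> \<open>Columns of \<open>?A\<close> are extensional on \<open>{1..n}\<close>, so
    overwriting the value at \<open>n + 1\<close> loses no information.\<close>
  have ext: "c (n + 1) = undefined" if "c \<in> col_idx ?A" for c
    using that by (auto simp: hierarchical_matrix_def PiE_def extensional_def)
  have "inj_on (?u k) (col_idx ?A)" for k
  proof (rule inj_onI)
    fix c c' assume "c \<in> col_idx ?A" "c' \<in> col_idx ?A" "?u k c = ?u k c'"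
    then show "c = c'" using ext by (metis fun_upd_triv fun_upd_upd)
  qed
  then show "inj_on (?u 1) (col_idx ?A)" "inj_on (?u 2) (col_idx ?A)" by blast+
  show "?u 1 ` col_idx ?A \<inter> ?u 2 ` col_idx ?A = {}"
    by (auto dest: fun_cong[of _ _ "n + 1"])
  have "{1..n + 1} = insert (n + 1) {1..n}" "{1..d (n + 1)} = {1, 2}" using d by auto
  then show "col_idx (hierarchical_matrix (n + 1) (lawrence_lifting n \<Delta>) d) =
      ?u 1 ` col_idx ?A \<union> ?u 2 ` col_idx ?A"
    by (auto simp: hierarchical_matrix_def PiE_insert_eq)
qed (rule mat_apply_lawrence_eq_iff[where d = d and n = n and \<Delta> = \<Delta>, OF assms])

section \<open>Injective matrices, and the two cases of the theorem\<close>

lemma normal_matrix_if_inj: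
  assumes "\<And>x y. mat_apply A x = mat_apply A y \<longleftrightarrow> (\<forall>c\<in>col_idx A. x c = y c)"
  shows "normal_matrix A"
  unfolding normal_matrix_iff assms by (auto simp: Nats_altdef2)

lemma unimodular_matrix_if_inj:
  assumes "\<And>x y. mat_apply A x = mat_apply A y \<longleftrightarrow> (\<forall>c\<in>col_idx A. x c = y c)"
  shows "unimodular_matrix A"
  unfolding unimodular_matrix_iff
proof (intro allI impI ballI)
  fix b z v c
  assume z: "\<forall>c\<in>col_idx A. z c \<in> \<int>" "mat_apply A z = b"
    and v: "v extreme_point_of fiber_polyhedron A b" and c: "c \<in> col_idx A"
  from v have "mat_apply A (Poly_Mapping.lookup v) = mat_apply A z"
    using z(2) by (simp add: extreme_point_of_def fiber_polyhedron_def)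
  then show "Poly_Mapping.lookup v c \<in> \<int>" using z(1) c unfolding assms by metis
qed

theorem theorem3p7:
  fixes n :: nat and \<C> :: "nat set set"
  assumes "complex_on n \<C>"
  shows "normal_matrix (binary_matrix (n + 1) (lawrence_lifting n \<C>)) \<longleftrightarrow>
         unimodular_matrix (binary_matrix n \<C>)"
proof (cases "{1..n} \<in> \<C>")
  case True
  have facets: "facets \<C> = {{1..n}}" using assms True by (rule facets_simplex)
  then have "{1..n + 1} \<in> lawrence_lifting n \<C>"
    by (auto simp: lawrence_lifting_def)
  with assms have "facets (lawrence_lifting n \<C>) = {{1..n + 1}}"
    by (intro facets_simplex complex_on_lawrence_lifting)
  then have "normal_matrix (binary_matrix (n + 1) (lawrence_lifting n \<C>))"
    unfolding binary_matrix_def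
    by (intro normal_matrix_if_inj mat_apply_hierarchical_simplex_eq_iff)
  moreover have "unimodular_matrix (binary_matrix n \<C>)"
    unfolding binary_matrix_def
    by (intro unimodular_matrix_if_inj mat_apply_hierarchical_simplex_eq_iff facets)
  ultimately show ?thesis by simp
next
  case False
  show ?thesis
    \<comment> \<open>\<open>refl\<close> supplies the two levels of the new vertex, as all levels
      are 2 in the binary case.\<close>
    unfolding binary_matrix_def normal_hierarchical_lawrence_iff[OF assms False refl]
    by (rule iffI[OF box_integral_imp_unimodular[OF finite_col_idx_hierarchical]
          unimodular_imp_box_integral[OF finite_col_idx_hierarchical]])
qed

end
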